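(* Let $\varphi$ be a normal form $\mathrm{FO}^2_{\mathrm{MOD}}[{\downarrow},{\downarrow^{+}},{\rightarrow},{\rightarrow^{+}}]$ formula. If $\varphi$ is satisfiable (over finite trees) then it has a tree model in which every path has length bounded by $\mathfrak{f}(\varphi)$ and every vertex has degree bounded by $\mathfrak{f}(\varphi)$.
   Context: $\mathrm{FO}^2_{\mathrm{MOD}}[{\downarrow},{\downarrow^{+}},{\rightarrow},{\rightarrow^{+}}]$: two-variable first-order logic over a signature of unary symbols $\tau_0$ plus ${\downarrow},{\downarrow^{+}},{\rightarrow},{\rightarrow^{+}}$, extended with modulo quantifiers $\exists^{\bowtie k,l}$ ($\bowtie\in\{\leq,=,\geq\}$, $l\ge1$, $0\le k<l$) with $\mathfrak{M},a\models\exists^{\bowtie k,l}y\,\phi(x,y)$ iff $(|\{b:\mathfrak{M}\models\phi[a,b]\}|\bmod l)\bowtie k$. It is interpreted over finite unranked ordered trees with nodes labeled by arbitrary subsets of $\tau_0$: ${\downarrow}$ child, ${\rightarrow}$ immediate right sibling, ${\downarrow^{+}},{\rightarrow^{+}}$ their transitive closures. Normal form: $\varphi=\forall x\forall y\,\chi(x,y)\wedge\bigwedge_{i=1}^n\forall x\exists y\,\chi_i(x,y)\wedge\bigwedge_{j=1}^m\forall x\,\exists^{\bowtie_j k_j,l_j}y\,\psi_j(x,y)$ with $n,m\ge1$, $\bowtie_j\in\{\le,\ge\}$, $\chi,\chi_i,\psi_j$ quantifier-free. An atomic 1-type is a maximal satisfiable set of atoms and negated atoms in the variable $x$ over the signature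 of $\varphi$; let $|\boldsymbol{\alpha}|$ be the number of such 1-types. Define $\mathfrak{f}(\varphi)=(2\,l_1l_2\cdots l_m)^{10\,|\boldsymbol{\alpha}|}$ (here $10$ is the number of order formulas for trees, describing the possible relative positions of two nodes: $x=y$, child, parent, proper descendant not child, proper ancestor not parent, right sibling, left sibling, following sibling not immediate, preceding sibling not immediate, and free position). *)

theory Defs
  imports Main
begin

text \<open>The type parameter \<open>'p\<close> is the set of unary symbols, so labels are arbitrary sets of unary
  symbols. A vertex is addressed by the list of child indices (from 0) leading to it from the root.\<close>

datatype 'p tree = Node (root_label: "'p set") (subtrees: "'p tree list")

primrec subtree_at :: "'p tree \<Rightarrow> nat list \<Rightarrow> 'p tree option" where
  "subtree_at t [] = Some t"
| "subtree_at t (i # u) =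
     (if i < length (subtrees t) then subtree_at (subtrees t ! i) u else None)"

definition nodes :: "'p tree \<Rightarrow> nat list set" where
  "nodes t = {u. subtree_at t u \<noteq> None}"

text \<open>Meaningful only for \<open>u \<in> nodes t\<close>.\<close>

definition label :: "'p tree \<Rightarrow> nat list \<Rightarrow> 'p set" where
  "label t u = root_label (the (subtree_at t u))"

definition child :: "'p tree \<Rightarrow> (nat list \<times> nat list) set" where
  "child t = {(u, v). u \<in> nodes t \<and> v \<in> nodes t \<and> (\<exists>i. v = u @ [i])}"

definition next_sibling :: "'p tree \<Rightarrow> (nat list \<times> nat list) set" where
  "next_sibling t =
     {(u, v). u \<in> nodes t \<and> v \<in> nodes t \<and> (\<exists>w i. u = w @ [i] \<and> v = w @ [Suc i])}"

text \<open>Paths run downwards and are given by their vertices, so the length of the list counts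
  vertices (one more than the number of edges).\<close>

definition path :: "'p tree \<Rightarrow> nat list list \<Rightarrow> bool" where
  "path t us \<longleftrightarrow> set us \<subseteq> nodes t \<and> successively (\<lambda>u v. (u, v) \<in> child t) us"

definition degree :: "'p tree \<Rightarrow> nat list \<Rightarrow> nat" where
  "degree t u = card {v. (u, v) \<in> child t}"


datatype var = X | Y

datatype cmp = Le | Equal | Ge

fun compare :: "cmp \<Rightarrow> nat \<Rightarrow> nat \<Rightarrow> bool" where
  "compare Le a b \<longleftrightarrow> a \<le> b"
| "compare Equal a b \<longleftrightarrow> a = b"
| "compare Ge a b \<longleftrightarrow> a \<ge> b"

text \<open>\<open>ExMod c k l v \<phi>\<close> is the quantifier with comparison \<open>c\<close>, threshold \<open>k\<close> and modulus \<open>l\<close>;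
  the side condition \<open>k < l\<close> (hence \<open>l \<ge> 1\<close>) is imposed by \<open>wf_mod\<close> below. The set function
  \<open>preds\<close> collects the unary symbols that occur in a formula.\<close>

datatype (preds: 'p) fo2 =
    Pred 'p var
  | Eql var var
  | Child var var
  | Desc var var
  | NextSib var var
  | FollSib var var
  | Neg "'p fo2"
  | Conj "'p fo2" "'p fo2"
  | Disj "'p fo2" "'p fo2"
  | Ex var "'p fo2"
  | All var "'p fo2"
  | ExMod cmp nat nat var "'p fo2"

primrec sat :: "'p tree \<Rightarrow> (var \<Rightarrow> nat list) \<Rightarrow> 'p fo2 \<Rightarrow> bool" where
  "sat t s (Pred p v) \<longleftrightarrow> p \<in> label t (s v)"
| "sat t s (Eql v w) \<longleftrightarrow> s v = s w"
| "sat t s (Child v w) \<longleftrightarrow> (s v, s w) \<in> child t"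
| "sat t s (Desc v w) \<longleftrightarrow> (s v, s w) \<in> (child t)\<^sup>+"
| "sat t s (NextSib v w) \<longleftrightarrow> (s v, s w) \<in> next_sibling t"
| "sat t s (FollSib v w) \<longleftrightarrow> (s v, s w) \<in> (next_sibling t)\<^sup>+"
| "sat t s (Neg f) \<longleftrightarrow> \<not> sat t s f"
| "sat t s (Conj f g) \<longleftrightarrow> sat t s f \<and> sat t s g"
| "sat t s (Disj f g) \<longleftrightarrow> sat t s f \<or> sat t s g"
| "sat t s (Ex v f) \<longleftrightarrow> (\<exists>b\<in>nodes t. sat t (s(v := b)) f)"
| "sat t s (All v f) \<longleftrightarrow> (\<forall>b\<in>nodes t. sat t (s(v := b)) f)"
| "sat t s (ExMod c k l v f) \<longleftrightarrow> compare c (card {b \<in> nodes t. sat t (s(v := b)) f} mod l) k"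

definition models :: "'p tree \<Rightarrow> 'p fo2 \<Rightarrow> bool" where
  "models t f \<longleftrightarrow> (\<forall>s. (\<forall>v. s v \<in> nodes t) \<longrightarrow> sat t s f)"

definition satisfiable :: "'p fo2 \<Rightarrow> bool" where
  "satisfiable f \<longleftrightarrow> (\<exists>t. models t f)"

primrec wf_mod :: "'p fo2 \<Rightarrow> bool" where
  "wf_mod (Pred p v) \<longleftrightarrow> True"
| "wf_mod (Eql v w) \<longleftrightarrow> True"
| "wf_mod (Child v w) \<longleftrightarrow> True"
| "wf_mod (Desc v w) \<longleftrightarrow> True"
| "wf_mod (NextSib v w) \<longleftrightarrow> True"
| "wf_mod (FollSib v w) \<longleftrightarrow> True"
| "wf_mod (Neg f) \<longleftrightarrow> wf_mod f"
| "wf_mod (Conj f g) \<longleftrightarrow> wf_mod f \<and> wf_mod g"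
| "wf_mod (Disj f g) \<longleftrightarrow> wf_mod f \<and> wf_mod g"
| "wf_mod (Ex v f) \<longleftrightarrow> wf_mod f"
| "wf_mod (All v f) \<longleftrightarrow> wf_mod f"
| "wf_mod (ExMod c k l v f) \<longleftrightarrow> k < l \<and> wf_mod f"

primrec quantifier_free :: "'p fo2 \<Rightarrow> bool" where
  "quantifier_free (Pred p v) \<longleftrightarrow> True"
| "quantifier_free (Eql v w) \<longleftrightarrow> True"
| "quantifier_free (Child v w) \<longleftrightarrow> True"
| "quantifier_free (Desc v w) \<longleftrightarrow> True"
| "quantifier_free (NextSib v w) \<longleftrightarrow> True"
| "quantifier_free (FollSib v w) \<longleftrightarrow> True"
| "quantifier_free (Neg f) \<longleftrightarrow> quantifier_free f"
| "quantifier_free (Conj f g) \<longleftrightarrow> quantifier_free f \<and> quantifier_free g"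
| "quantifier_free (Disj f g) \<longleftrightarrow> quantifier_free f \<and> quantifier_free g"
| "quantifier_free (Ex v f) \<longleftrightarrow> False"
| "quantifier_free (All v f) \<longleftrightarrow> False"
| "quantifier_free (ExMod c k l v f) \<longleftrightarrow> False"

text \<open>The conjunction of the normal form is bracketed to the left.\<close>

definition normal_form :: "'p fo2 \<Rightarrow> bool" where
  "normal_form \<phi> \<longleftrightarrow> wf_mod \<phi> \<and>
     (\<exists>\<chi> \<chi>s \<psi>s.
        \<phi> = foldl Conj (All X (All Y \<chi>))
              (map (\<lambda>\<chi>i. All X (Ex Y \<chi>i)) \<chi>s @
               map (\<lambda>(c, k, l, \<psi>). All X (ExMod c k l Y \<psi>)) \<psi>s) \<and>
        \<chi>s \<noteq> [] \<and> \<psi>s \<noteq> [] \<and>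
        quantifier_free \<chi> \<and>
        (\<forall>\<chi>i \<in> set \<chi>s. quantifier_free \<chi>i) \<and>
        (\<forall>(c, k, l, \<psi>) \<in> set \<psi>s. c \<in> {Le, Ge} \<and> quantifier_free \<psi>))"


definition atoms_x :: "'p fo2 \<Rightarrow> 'p fo2 set" where
  "atoms_x \<phi> = {Pred p X | p. p \<in> preds \<phi>} \<union>
     {Eql X X, Child X X, Desc X X, NextSib X X, FollSib X X}"

definition literals_x :: "'p fo2 \<Rightarrow> 'p fo2 set" where
  "literals_x \<phi> = atoms_x \<phi> \<union> Neg ` atoms_x \<phi>"

text \<open>All literals considered have \<open>X\<close> as their only variable, so the value of \<open>Y\<close> is immaterial.\<close>

definition satisfiable_x :: "'p fo2 set \<Rightarrow> bool" where
  "satisfiable_x S \<longleftrightarrow> (\<exists>t. \<exists>a\<in>nodes t. \<forall>f\<in>S. sat t (\<lambda>_. a) f)"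

definition one_types :: "'p fo2 \<Rightarrow> 'p fo2 set set" where
  "one_types \<phi> = {S. S \<subseteq> literals_x \<phi> \<and> satisfiable_x S \<and>
     (\<forall>S'. S \<subset> S' \<and> S' \<subseteq> literals_x \<phi> \<longrightarrow> \<not> satisfiable_x S')}"

text \<open>The moduli of all modulo quantifiers, with repetitions; for a formula in normal form this is
  \<open>[l\<^sub>1, \<dots>, l\<^sub>m]\<close>.\<close>

primrec moduli :: "'p fo2 \<Rightarrow> nat list" where
  "moduli (Pred p v) = []"
| "moduli (Eql v w) = []"
| "moduli (Child v w) = []"
| "moduli (Desc v w) = []"
| "moduli (NextSib v w) = []"
| "moduli (FollSib v w) = []"
| "moduli (Neg f) = moduli f"
| "moduli (Conj f g) = moduli f @ moduli g"
| "moduli (Disj f g) = moduli f @ moduli g"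
| "moduli (Ex v f) = moduli f"
| "moduli (All v f) = moduli f"
| "moduli (ExMod c k l v f) = l # moduli f"

text \<open>The factor 10 is the number of possible relative positions of two vertices of an ordered tree:
  equal, child, parent, proper descendant but not child, proper ancestor but not parent, right
  sibling, left sibling, non-immediate following sibling, non-immediate preceding sibling, and
  none of these.\<close>

definition size_bound :: "'p fo2 \<Rightarrow> nat" where
  "size_bound \<phi> = (2 * prod_list (moduli \<phi>)) ^ (10 * card (one_types \<phi>))"

end

theory Submission
  imports Defs "HOL-Library.FuncSet"
begin

text \<open>Take a model with the fewest vertices. The truth of a normal-form formula is determined by the
  numbers, for each vertex and each relative position, of vertices with a given label in that
  position, and these numbers matter only modulo the product of the moduli and up to being zero.
  If two distinct vertices \<open>u\<close>, \<open>v\<close> on a path, or two siblings, agree on suitable counts of this kind,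
  then everything that hangs from \<open>u\<close> and its right siblings can be replaced by what hangs from \<open>v\<close>
  and its right siblings without changing the counts seen by any surviving vertex, which contradicts
  minimality. So paths and sibling lists are no longer than the number of possible counts; eight
  kinds of position, fewer than the ten of the bound, suffice.\<close>

section \<open>Counting up to a modulus and up to being zero\<close>

text \<open>The residue serves the modulo quantifiers, the zero test serves the plain ones. Both
  survive addition, since a sum of naturals vanishes only if both summands do; so counts can be
  assembled from disjoint pieces.\<close>

definition cong_count :: "nat \<Rightarrow> nat \<Rightarrow> nat \<Rightarrow> bool" where
  "cong_count L m n \<longleftrightarrow> m mod L = n mod L \<and> (m = 0 \<longleftrightarrow> n = 0)"

lemma cong_count_refl [simp]: "cong_count L m m"
  by (simp add: cong_count_def)

lemma cong_count_add:
  assumes "cong_count L a b" "cong_count L c d"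
  shows "cong_count L (a + c) (b + d)"
  using assms unfolding cong_count_def by (auto intro: mod_add_cong)

lemma cong_count_sum:
  assumes "finite K" "\<And>k. k \<in> K \<Longrightarrow> cong_count L (f k) (g k)"
  shows "cong_count L (sum f K) (sum g K)"
  using assms by (induction K rule: finite_induct) (auto intro: cong_count_add)

lemma cong_count_dvd:
  assumes "cong_count L m n" "l dvd L"
  shows "m mod l = n mod l"
  using assms unfolding cong_count_def by (metis mod_mod_cancel)

text \<open>The functions act as colourings. Each set has its own, so that vertices of different
  trees, or views from different vertices, can be compared.\<close>

definition similar :: "nat \<Rightarrow> 'a set \<Rightarrow> ('a \<Rightarrow> 'k) \<Rightarrow> 'b set \<Rightarrow> ('b \<Rightarrow> 'k) \<Rightarrow> bool" where
  "similar L A \<kappa> B \<kappa>' \<longleftrightarrow> (\<forall>k. cong_count L (card {a\<in>A. \<kappa> a = k}) (card {b\<in>B. \<kappa>' b = k}))"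

lemma similar_sym: "similar L A \<kappa> B \<kappa>' \<Longrightarrow> similar L B \<kappa>' A \<kappa>"
  unfolding similar_def cong_count_def by metis

lemma similar_trans:
  "similar L A \<kappa> B \<kappa>' \<Longrightarrow> similar L B \<kappa>' C \<kappa>'' \<Longrightarrow> similar L A \<kappa> C \<kappa>''"
  unfolding similar_def cong_count_def by metis

lemma similar_obtain:
  assumes "similar L A \<kappa> B \<kappa>'" "finite A" "a \<in> A"
  obtains b where "b \<in> B" "\<kappa>' b = \<kappa> a"
proof -
  have "card {x\<in>A. \<kappa> x = \<kappa> a} \<noteq> 0"
    using assms by auto
  then have "card {b\<in>B. \<kappa>' b = \<kappa> a} \<noteq> 0"
    using assms unfolding similar_def cong_count_def by metis
  then have "{b\<in>B. \<kappa>' b = \<kappa> a} \<noteq> {}"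
    by (metis card.empty)
  then show ?thesis
    using that by blast
qed

text \<open>By the zero test a colour present on one side is present on the other, so
  \<open>PQ\<close> makes \<open>P\<close> and \<open>Q\<close> constant on colour classes. Both
  sets are then disjoint unions of the classes with colours in the same finite \<open>K\<close>, and
  the counts add up.\<close>

lemma similar_card_pred:
  assumes fin: "finite A" "finite B" and sim: "similar L A \<kappa> B \<kappa>'"
    and PQ: "\<And>a b. a \<in> A \<Longrightarrow> b \<in> B \<Longrightarrow> \<kappa> a = \<kappa>' b \<Longrightarrow> P a = Q b"
  shows "cong_count L (card {a\<in>A. P a}) (card {b\<in>B. Q b})"
proof -
  define K where "K = \<kappa> ` {a\<in>A. P a}"
  have K': "K = \<kappa>' ` {b\<in>B. Q b}"
    unfolding K_def using PQ similar_obtain[OF sim fin(1)]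
      similar_obtain[OF similar_sym[OF sim] fin(2)]
    by (smt (verit) Collect_cong image_def mem_Collect_eq)
  have P: "P a" if "a \<in> A" "\<kappa> a \<in> K" for a
    using that PQ unfolding K' by blast
  have Q: "Q b" if "b \<in> B" "\<kappa>' b \<in> K" for b
    using that PQ unfolding K_def by (metis (no_types, lifting) image_iff mem_Collect_eq)
  have "{a\<in>A. P a} = (\<Union>k\<in>K. {a\<in>A. \<kappa> a = k})"
    using P by (auto simp: K_def)
  moreover have "{b\<in>B. Q b} = (\<Union>k\<in>K. {b\<in>B. \<kappa>' b = k})"
    using Q by (auto simp: K')
  moreover have finK: "finite K"
    using fin by (simp add: K_def)
  ultimately have "card {a\<in>A. P a} = (\<Sum>k\<in>K. card {a\<in>A. \<kappa> a = k})"
    "card {b\<in>B. Q b} = (\<Sum>k\<in>K. card {b\<in>B. \<kappa>' b = k})"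
    using fin by (auto simp: card_UN_disjoint disjoint_iff)
  then show ?thesis
    using cong_count_sum[OF finK] sim unfolding similar_def by presburger
qed

lemma similar_coarsen:
  assumes "finite A" "finite B" "similar L A \<kappa> B \<kappa>'"
    and "\<And>a b. a \<in> A \<Longrightarrow> b \<in> B \<Longrightarrow> \<kappa> a = \<kappa>' b \<Longrightarrow> \<mu> a = \<mu>' b"
  shows "similar L A \<mu> B \<mu>'"
  unfolding similar_def
proof
  fix k
  show "cong_count L (card {a\<in>A. \<mu> a = k}) (card {b\<in>B. \<mu>' b = k})"
    by (rule similar_card_pred[OF assms(1-3)]) (simp add: assms(4))
qed

lemma similar_filter:
  assumes "similar L A \<kappa> B \<kappa>'"
  shows "similar L {a\<in>A. P (\<kappa> a)} \<kappa> {b\<in>B. P (\<kappa>' b)} \<kappa>'"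
  unfolding similar_def
proof
  fix k
  have "{a \<in> {a\<in>A. P (\<kappa> a)}. \<kappa> a = k} = (if P k then {a\<in>A. \<kappa> a = k} else {})"
    "{b \<in> {b\<in>B. P (\<kappa>' b)}. \<kappa>' b = k} = (if P k then {b\<in>B. \<kappa>' b = k} else {})"
    by auto
  then show "cong_count L (card {a \<in> {a\<in>A. P (\<kappa> a)}. \<kappa> a = k})
      (card {b \<in> {b\<in>B. P (\<kappa>' b)}. \<kappa>' b = k})"
    using assms unfolding similar_def by simp
qed

lemma similar_Un:
  assumes fin: "finite A" "finite B" "finite A'" "finite B'"
    and disj: "A \<inter> A' = {}" "B \<inter> B' = {}"
    and "similar L A \<kappa> B \<kappa>'" "similar L A' \<kappa> B' \<kappa>'"
  shows "similar L (A \<union> A') \<kappa> (B \<union> B') \<kappa>'"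
  unfolding similar_def
proof
  fix k
  have "{a \<in> A \<union> A'. \<kappa> a = k} = {a\<in>A. \<kappa> a = k} \<union> {a\<in>A'. \<kappa> a = k}"
    "{b \<in> B \<union> B'. \<kappa>' b = k} = {b\<in>B. \<kappa>' b = k} \<union> {b\<in>B'. \<kappa>' b = k}"
    by auto
  moreover have "{a\<in>A. \<kappa> a = k} \<inter> {a\<in>A'. \<kappa> a = k} = {}"
    "{b\<in>B. \<kappa>' b = k} \<inter> {b\<in>B'. \<kappa>' b = k} = {}"
    using disj by auto
  ultimately show "cong_count L (card {a \<in> A \<union> A'. \<kappa> a = k}) (card {b \<in> B \<union> B'. \<kappa>' b = k})"
    using assms unfolding similar_def by (simp add: card_Un_disjoint cong_count_add)
qed

lemma similar_bij:
  assumes "bij_betw g A B" "\<And>a. a \<in> A \<Longrightarrow> \<kappa> a = \<kappa>' (g a)"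
  shows "similar L A \<kappa> B \<kappa>'"
  unfolding similar_def
proof
  fix k
  have "bij_betw g {a\<in>A. \<kappa> a = k} {b\<in>B. \<kappa>' b = k}"
    using assms unfolding bij_betw_def by (auto intro: inj_on_subset)
  then show "cong_count L (card {a\<in>A. \<kappa> a = k}) (card {b\<in>B. \<kappa>' b = k})"
    by (simp add: bij_betw_same_card)
qed

section \<open>Trees as sets of addresses\<close>

lemma Nil_in_nodes [simp]: "[] \<in> nodes t"
  by (simp add: nodes_def)

lemma Cons_in_nodes [simp]:
  "i # u \<in> nodes t \<longleftrightarrow> i < length (subtrees t) \<and> u \<in> nodes (subtrees t ! i)"
  by (simp add: nodes_def)

lemma label_Cons:
  "i < length (subtrees t) \<Longrightarrow> label t (i # u) = label (subtrees t ! i) u"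
  by (simp add: label_def)

lemma finite_nodes: "finite (nodes t)"
proof (induction t)
  case (Node a ts)
  have "nodes (Node a ts) \<subseteq> insert [] (\<Union>i<length ts. Cons i ` nodes (ts ! i))"
  proof
    fix u assume "u \<in> nodes (Node a ts)"
    then show "u \<in> insert [] (\<Union>i<length ts. Cons i ` nodes (ts ! i))"
      by (cases u) auto
  qed
  then show ?case
    using Node by (auto intro: finite_subset)
qed

lemma nodes_appendD: "u @ w \<in> nodes t \<Longrightarrow> u \<in> nodes t"
  by (induction u arbitrary: t) auto

lemma nodes_left_sibling: "u @ [j] \<in> nodes t \<Longrightarrow> i \<le> j \<Longrightarrow> u @ [i] \<in> nodes t"
  by (induction u arbitrary: t) auto

text \<open>This lets a surgery be described by the surviving addresses alone. By induction on the
  cardinality, the addresses starting with \<open>i\<close>, with that index removed, form the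
  domain of the \<open>i\<close>-th subtree.\<close>

lemma tree_with_domain:
  fixes S :: "nat list set" and f :: "nat list \<Rightarrow> 'p set"
  assumes "finite S" "[] \<in> S"
    and "\<And>u i. u @ [i] \<in> S \<Longrightarrow> u \<in> S"
    and "\<And>u i. u @ [Suc i] \<in> S \<Longrightarrow> u @ [i] \<in> S"
  shows "\<exists>t. nodes t = S \<and> (\<forall>u\<in>S. label t u = f u)"
  using assms
proof (induction "card S" arbitrary: S f rule: less_induct)
  case less
  have prefix: "u \<in> S" if "u @ w \<in> S" for u w
    using that by (induction w rule: rev_induct) (auto intro: less.prems(3) simp flip: append_assoc)
  \<comment> \<open>This is the number of children of the root: closure under left siblings makes
    the one-element addresses in \<open>S\<close> exactly those with index below the least missing
    one.\<close>
  define n where "n = (LEAST n. [n] \<notin> S)"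
  have "finite {i. [i] \<in> S}"
    using finite_vimageI[OF less.prems(1), of "\<lambda>i. [i]"] by (simp add: inj_def vimage_def)
  then have "\<exists>n. [n] \<notin> S"
    by (metis ex_new_if_finite infinite_UNIV_nat mem_Collect_eq)
  then have "[n] \<notin> S"
    unfolding n_def by (rule LeastI_ex)
  moreover have "[i] \<notin> S" if "n \<le> i" for i
    using that \<open>[n] \<notin> S\<close> less.prems(4)[of "[]"] by (induction rule: dec_induct) auto
  ultimately have n: "[i] \<in> S \<longleftrightarrow> i < n" for i
    unfolding n_def by (metis not_less not_less_Least)
  have "\<exists>t. nodes t = {w. i # w \<in> S} \<and> (\<forall>u\<in>{w. i # w \<in> S}. label t u = f (i # u))"
    if "i < n" for i
  proof (rule less.hyps)
    have sub: "Cons i ` {w. i # w \<in> S} \<subset> S"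
      using less.prems(2) by blast
    then have "card (Cons i ` {w. i # w \<in> S}) < card S"
      by (rule psubset_card_mono[OF less.prems(1)])
    then show "card {w. i # w \<in> S} < card S"
      by (simp add: card_image)
    have "finite (Cons i ` {w. i # w \<in> S})"
      using sub less.prems(1) finite_subset by blast
    then show "finite {w. i # w \<in> S}"
      by (simp add: finite_image_iff)
    show "[] \<in> {w. i # w \<in> S}"
      using n that by simp
    show "\<And>u k. u @ [k] \<in> {w. i # w \<in> S} \<Longrightarrow> u \<in> {w. i # w \<in> S}"
      using less.prems(3)[of "i # _"] by simp
    show "\<And>u k. u @ [Suc k] \<in> {w. i # w \<in> S} \<Longrightarrow> u @ [k] \<in> {w. i # w \<in> S}"
      using less.prems(4)[of "i # _"] by simp
  qed
  then have "\<forall>i. \<exists>t. i < n \<longrightarrow>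
      nodes t = {w. i # w \<in> S} \<and> (\<forall>u\<in>{w. i # w \<in> S}. label t u = f (i # u))"
    by blast
  from choice[OF this] obtain T where T: "\<And>i. i < n \<Longrightarrow> nodes (T i) = {w. i # w \<in> S}"
    "\<And>i u. i < n \<Longrightarrow> i # u \<in> S \<Longrightarrow> label (T i) u = f (i # u)"
    by blast
  define t where "t = Node (f []) (map T [0..<n])"
  have head: "i < n" if "i # u \<in> S" for i u
    using prefix[of "[i]" u] that n by simp
  have "u \<in> nodes t \<longleftrightarrow> u \<in> S" for u
    using less.prems(2) T(1) head by (cases u) (auto simp: t_def)
  moreover have "label t u = f u" if "u \<in> S" for u
    using that T(2) head by (cases u) (simp_all add: t_def label_Cons label_def[of _ "[]"])
  ultimately show ?case
    by blast
qed

section \<open>Relative positions of two addresses\<close>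

text \<open>\<open>pos u v\<close> is the position of \<open>v\<close> as seen from \<open>u\<close>.\<close>

datatype position =
    Equal_Pos | Child_Pos | Parent_Pos | Desc_Pos | Anc_Pos
  | Right_Pos | Left_Pos | Foll_Pos | Prec_Pos | Free_Pos

fun pos :: "nat list \<Rightarrow> nat list \<Rightarrow> position" where
  "pos [] [] = Equal_Pos"
| "pos [] (j # v) = (if v = [] then Child_Pos else Desc_Pos)"
| "pos (i # u) [] = (if u = [] then Parent_Pos else Anc_Pos)"
| "pos (i # u) (j # v) =
     (if i = j then pos u v
      else if u = [] \<and> v = []
        then (if j = Suc i then Right_Pos else if i = Suc j then Left_Pos
              else if i < j then Foll_Pos else Prec_Pos)
      else Free_Pos)"

fun converse_pos :: "position \<Rightarrow> position" where
  "converse_pos Child_Pos = Parent_Pos"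
| "converse_pos Parent_Pos = Child_Pos"
| "converse_pos Desc_Pos = Anc_Pos"
| "converse_pos Anc_Pos = Desc_Pos"
| "converse_pos Right_Pos = Left_Pos"
| "converse_pos Left_Pos = Right_Pos"
| "converse_pos Foll_Pos = Prec_Pos"
| "converse_pos Prec_Pos = Foll_Pos"
| "converse_pos Equal_Pos = Equal_Pos"
| "converse_pos Free_Pos = Free_Pos"

lemma pos_converse: "pos v u = converse_pos (pos u v)"
  by (induction u v rule: pos.induct) auto

lemma pos_refl [simp]: "pos u u = Equal_Pos"
  by (induction u) auto

lemma pos_append [simp]: "pos (p @ u) (p @ v) = pos u v"
  by (induction p) auto

lemma pos_eq: "pos u v = Equal_Pos \<longleftrightarrow> u = v"
  by (induction u v rule: pos.induct) auto

lemma pos_child: "pos u v = Child_Pos \<longleftrightarrow> (\<exists>i. v = u @ [i])"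
  by (induction u v rule: pos.induct) auto

lemma pos_below: "pos u v \<in> {Child_Pos, Desc_Pos} \<longleftrightarrow> (\<exists>w. w \<noteq> [] \<and> v = u @ w)"
  by (induction u v rule: pos.induct) auto

lemma pos_siblingD:
  assumes "pos u v \<in> {Right_Pos, Foll_Pos}"
  shows "\<exists>w i j. i < j \<and> u = w @ [i] \<and> v = w @ [j]"
  using assms
proof (induction u v rule: pos.induct)
  case (4 i u j v)
  show ?case
  proof (cases "i = j")
    case True
    with 4 obtain w k l where "k < l" "u = w @ [k]" "v = w @ [l]"
      by auto
    with True have "k < l \<and> i # u = (i # w) @ [k] \<and> j # v = (i # w) @ [l]"
      by simp
    then show ?thesis
      by blast
  next
    case False
    with 4 have "i < j \<and> i # u = [] @ [i] \<and> j # v = [] @ [j]"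
      by (auto split: if_splits)
    then show ?thesis
      by blast
  qed
qed (auto split: if_splits)

lemma pos_following:
  "pos u v \<in> {Right_Pos, Foll_Pos} \<longleftrightarrow> (\<exists>w i j. i < j \<and> u = w @ [i] \<and> v = w @ [j])"
  using pos_siblingD[of u v] by (auto split: if_splits)

lemma pos_right: "pos u v = Right_Pos \<longleftrightarrow> (\<exists>w i. u = w @ [i] \<and> v = w @ [Suc i])"
proof
  assume *: "pos u v = Right_Pos"
  then obtain w i j where "u = w @ [i]" "v = w @ [j]"
    using pos_siblingD[of u v] by auto
  with * show "\<exists>w i. u = w @ [i] \<and> v = w @ [Suc i]"
    by (simp split: if_splits)
qed auto

lemma child_iff:
  assumes "u \<in> nodes t" "v \<in> nodes t"
  shows "(u, v) \<in> child t \<longleftrightarrow> pos u v = Child_Pos"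
  using assms by (simp add: child_def pos_child)

text \<open>A prefix of a vertex address is again a vertex, so the downward walk from
  \<open>u\<close> to \<open>v\<close> stays in the tree and the addresses alone decide the
  relation.\<close>

lemma descendant_iff:
  assumes "u \<in> nodes t" "v \<in> nodes t"
  shows "(u, v) \<in> (child t)\<^sup>+ \<longleftrightarrow> pos u v \<in> {Child_Pos, Desc_Pos}"
  unfolding pos_below
proof
  assume "(u, v) \<in> (child t)\<^sup>+"
  then show "\<exists>w. w \<noteq> [] \<and> v = u @ w"
  proof induction
    case (base y)
    then show ?case
      by (auto simp: child_def)
  next
    case (step y z)
    then obtain w i where "y = u @ w" "z = y @ [i]"
      by (auto simp: child_def)
    then have "w @ [i] \<noteq> [] \<and> z = u @ w @ [i]"
      by simp
    then show ?case
      by blast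
  qed
next
  assume "\<exists>w. w \<noteq> [] \<and> v = u @ w"
  then obtain w where "w \<noteq> []" "v = u @ w"
    by blast
  have "(u, u @ w) \<in> (child t)\<^sup>+" if "w \<noteq> []" "u @ w \<in> nodes t" for w
    using that
  proof (induction w rule: rev_induct)
    case (snoc i w)
    then have *: "(u @ w, u @ w @ [i]) \<in> child t"
      using nodes_appendD[of "u @ w" "[i]"] by (auto simp: child_def)
    then show ?case
      using snoc nodes_appendD[of "u @ w" "[i]"]
      by (cases "w = []") (auto intro: trancl_into_trancl)
  qed simp
  with \<open>w \<noteq> []\<close> \<open>v = u @ w\<close> assms show "(u, v) \<in> (child t)\<^sup>+"
    by simp
qed

lemma next_sibling_iff:
  assumes "u \<in> nodes t" "v \<in> nodes t"
  shows "(u, v) \<in> next_sibling t \<longleftrightarrow> pos u v = Right_Pos"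
  using assms by (simp add: next_sibling_def pos_right)

text \<open>Here closure under left siblings keeps the intermediate siblings in the tree.\<close>

lemma following_sibling_iff:
  assumes "u \<in> nodes t" "v \<in> nodes t"
  shows "(u, v) \<in> (next_sibling t)\<^sup>+ \<longleftrightarrow> pos u v \<in> {Right_Pos, Foll_Pos}"
  unfolding pos_following
proof
  assume "(u, v) \<in> (next_sibling t)\<^sup>+"
  then show "\<exists>w i j. i < j \<and> u = w @ [i] \<and> v = w @ [j]"
    by induction (fastforce simp: next_sibling_def)+
next
  assume "\<exists>w i j. i < j \<and> u = w @ [i] \<and> v = w @ [j]"
  then obtain w i j where "i < j" "u = w @ [i]" "v = w @ [j]"
    by blast
  moreover have "(w @ [i], w @ [i + Suc d]) \<in> (next_sibling t)\<^sup>+"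
    if "w @ [i + Suc d] \<in> nodes t" for d
    using that
  proof (induction d)
    case 0
    then show ?case
      using nodes_left_sibling[of w "Suc i" t i] by (auto simp: next_sibling_def)
  next
    case (Suc d)
    then have "w @ [i + Suc d] \<in> nodes t"
      using nodes_left_sibling[OF Suc.prems, of "i + Suc d"] by simp
    moreover from this have "(w @ [i + Suc d], w @ [i + Suc (Suc d)]) \<in> next_sibling t"
      using Suc.prems by (auto simp: next_sibling_def)
    ultimately show ?case
      using Suc.IH by (metis trancl_into_trancl)
  qed
  ultimately show "(u, v) \<in> (next_sibling t)\<^sup>+"
    using assms less_imp_Suc_add[of i j] by auto
qed

section \<open>Transfer of normal-form formulas\<close>

lemma sat_transfer:
  assumes "quantifier_free f" "preds f \<subseteq> P"
    and "\<And>v. s v \<in> nodes t" "\<And>v. s' v \<in> nodes t'"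
    and "\<And>v w. pos (s v) (s w) = pos (s' v) (s' w)"
    and "\<And>v. label t (s v) \<inter> P = label t' (s' v) \<inter> P"
  shows "sat t s f \<longleftrightarrow> sat t' s' f"
  using assms(1,2)
proof (induction f)
  case (Pred p v)
  then show ?case
    using assms(6)[of v] by auto
next
  case (Eql v w)
  then show ?case
    using assms(5) pos_eq by (metis sat.simps(2))
qed (simp_all add: assms child_iff descendant_iff next_sibling_iff following_sibling_iff)

abbreviation env :: "'a \<Rightarrow> 'a \<Rightarrow> var \<Rightarrow> 'a" where
  "env a b \<equiv> (\<lambda>v. case v of X \<Rightarrow> a | Y \<Rightarrow> b)"

lemma sat_env_transfer:
  assumes "quantifier_free f" "preds f \<subseteq> P"
    and "a \<in> nodes t" "b \<in> nodes t" "a' \<in> nodes t'" "b' \<in> nodes t'"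
    and "pos a b = pos a' b'"
    and "label t a \<inter> P = label t' a' \<inter> P" "label t b \<inter> P = label t' b' \<inter> P"
  shows "sat t (env a b) f \<longleftrightarrow> sat t' (env a' b') f"
proof (rule sat_transfer[OF assms(1,2)])
  \<comment> \<open>Only the position of \<open>b\<close> seen from \<open>a\<close> is given; the
    reverse one is its converse.\<close>
  show "pos (env a b v) (env a b w) = pos (env a' b' v) (env a' b' w)" for v w
    using assms(7) pos_converse[of b a] pos_converse[of b' a'] by (cases v; cases w) auto
qed (use assms in \<open>auto split: var.split\<close>)

lemma env_upd: "(s(X := a))(Y := b) = env a b"
  by (auto split: var.split)

lemma sat_foldl_Conj:
  "sat t s (foldl Conj f fs) \<longleftrightarrow> sat t s f \<and> (\<forall>g\<in>set fs. sat t s g)"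
  by (induction fs arbitrary: f) auto

lemma preds_foldl_Conj: "preds (foldl Conj f fs) = preds f \<union> (\<Union>g\<in>set fs. preds g)"
  by (induction fs arbitrary: f) auto

lemma moduli_foldl_Conj:
  "set (moduli (foldl Conj f fs)) = set (moduli f) \<union> (\<Union>g\<in>set fs. set (moduli g))"
  by (induction fs arbitrary: f) auto

lemma moduli_pos: "wf_mod f \<Longrightarrow> l \<in> set (moduli f) \<Longrightarrow> 0 < l"
  by (induction f) auto

lemma finite_preds: "finite (preds f)"
  by (induction f) auto

text \<open>Apart from the label of \<open>a\<close>, this is all that a quantifier-free formula
  over \<open>P\<close> can see of the pair.\<close>

definition profile :: "'p set \<Rightarrow> 'p tree \<Rightarrow> nat list \<Rightarrow> nat list \<Rightarrow> position \<times> 'p set" where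
  "profile P t a b = (pos a b, label t b \<inter> P)"

text \<open>Each vertex \<open>a\<close> of \<open>t'\<close> imitates \<open>g a\<close>; the map
  need not preserve positions. Profiles seen in \<open>t'\<close> occur in \<open>t\<close>
  (universal part) and conversely (existential part), and every modulus divides the product, so
  residues agree (modulo part).\<close>

lemma models_transfer:
  fixes \<phi> :: "'p fo2"
  assumes nf: "normal_form \<phi>" and mod: "models t \<phi>"
    and g: "\<And>a. a \<in> nodes t' \<Longrightarrow> g a \<in> nodes t"
    and lab: "\<And>a. a \<in> nodes t' \<Longrightarrow> label t' a \<inter> preds \<phi> = label t (g a) \<inter> preds \<phi>"
    and sim: "\<And>a. a \<in> nodes t' \<Longrightarrow> similar (prod_list (moduli \<phi>))
      (nodes t') (profile (preds \<phi>) t' a) (nodes t) (profile (preds \<phi>) t (g a))"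
  shows "models t' \<phi>"
proof -
  let ?L = "prod_list (moduli \<phi>)"
  obtain \<chi> \<chi>s \<psi>s where \<phi>: "\<phi> = foldl Conj (All X (All Y \<chi>))
      (map (\<lambda>\<chi>i. All X (Ex Y \<chi>i)) \<chi>s @ map (\<lambda>(c, k, l, \<psi>). All X (ExMod c k l Y \<psi>)) \<psi>s)"
    and qf: "quantifier_free \<chi>" "\<forall>\<chi>i \<in> set \<chi>s. quantifier_free \<chi>i"
      "\<forall>(c, k, l, \<psi>) \<in> set \<psi>s. c \<in> {Le, Ge} \<and> quantifier_free \<psi>"
    using nf unfolding normal_form_def by blast
  have models_iff: "models u \<phi> \<longleftrightarrow> (\<forall>a\<in>nodes u.
      (\<forall>b\<in>nodes u. sat u (env a b) \<chi>) \<and>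
      (\<forall>\<chi>i\<in>set \<chi>s. \<exists>b\<in>nodes u. sat u (env a b) \<chi>i) \<and>
      (\<forall>(c, k, l, \<psi>)\<in>set \<psi>s. compare c (card {b\<in>nodes u. sat u (env a b) \<psi>} mod l) k))"
    for u :: "'p tree"
  proof -
    have "sat u s \<phi> \<longleftrightarrow> (\<forall>a\<in>nodes u.
      (\<forall>b\<in>nodes u. sat u (env a b) \<chi>) \<and>
      (\<forall>\<chi>i\<in>set \<chi>s. \<exists>b\<in>nodes u. sat u (env a b) \<chi>i) \<and>
      (\<forall>(c, k, l, \<psi>)\<in>set \<psi>s. compare c (card {b\<in>nodes u. sat u (env a b) \<psi>} mod l) k))" for s
      unfolding \<phi> sat_foldl_Conj by (simp add: ball_Un env_upd split_def) blast
    then show ?thesis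
      \<comment> \<open>The sentence has no free variables, so instantiating the environment with
        the root suffices.\<close>
      unfolding models_def by (auto dest: spec[of _ "\<lambda>_. []"])
  qed
  have pr: "preds \<chi> \<subseteq> preds \<phi>" "\<chi>i \<in> set \<chi>s \<Longrightarrow> preds \<chi>i \<subseteq> preds \<phi>"
    "(c, k, l, \<psi>) \<in> set \<psi>s \<Longrightarrow> preds \<psi> \<subseteq> preds \<phi>" for \<chi>i c k l \<psi>
    unfolding \<phi> preds_foldl_Conj by force+
  have dvd: "l dvd ?L" if "(c, k, l, \<psi>) \<in> set \<psi>s" for c k l \<psi>
  proof -
    have "l \<in> set (moduli \<phi>)"
      using that unfolding \<phi> moduli_foldl_Conj by force
    then show ?thesis
      by (rule prod_list_dvd)
  qed
  show ?thesis
    unfolding models_iff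
  proof (intro ballI conjI)
    fix a assume a: "a \<in> nodes t'"
    have same: "sat t' (env a b) f \<longleftrightarrow> sat t (env (g a) b') f"
      if "b \<in> nodes t'" "b' \<in> nodes t" "quantifier_free f" "preds f \<subseteq> preds \<phi>"
        "profile (preds \<phi>) t' a b = profile (preds \<phi>) t (g a) b'" for b b' f
      using that a g[OF a] lab[OF a]
      by (intro sat_env_transfer[of f "preds \<phi>"]) (auto simp: profile_def)
    {
      fix b assume b: "b \<in> nodes t'"
      obtain b' where "b' \<in> nodes t" "profile (preds \<phi>) t (g a) b' = profile (preds \<phi>) t' a b"
        using similar_obtain[OF sim[OF a] finite_nodes b] .
      then show "sat t' (env a b) \<chi>"
        using same[OF b, of b' \<chi>] qf(1) pr(1) mod g[OF a] unfolding models_iff by auto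
    next
      fix \<chi>i assume \<chi>i: "\<chi>i \<in> set \<chi>s"
      then obtain b' where b': "b' \<in> nodes t" "sat t (env (g a) b') \<chi>i"
        using mod g[OF a] unfolding models_iff by blast
      obtain b where "b \<in> nodes t'" "profile (preds \<phi>) t' a b = profile (preds \<phi>) t (g a) b'"
        using similar_obtain[OF similar_sym[OF sim[OF a]] finite_nodes b'(1)] .
      then show "\<exists>b\<in>nodes t'. sat t' (env a b) \<chi>i"
        using same[of b b' \<chi>i] b' qf(2) pr(2) \<chi>i by blast
    next
      fix q assume q: "q \<in> set \<psi>s"
      obtain c k l \<psi> where ckl: "q = (c, k, l, \<psi>)"
        by (cases q) auto
      have "quantifier_free \<psi>" "preds \<psi> \<subseteq> preds \<phi>"
        using q ckl qf(3) pr(3) by auto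
      then have "cong_count ?L (card {b\<in>nodes t'. sat t' (env a b) \<psi>})
          (card {b\<in>nodes t. sat t (env (g a) b) \<psi>})"
        by (intro similar_card_pred[OF finite_nodes finite_nodes sim[OF a]] same) auto
      then have "card {b\<in>nodes t'. sat t' (env a b) \<psi>} mod l
          = card {b\<in>nodes t. sat t (env (g a) b) \<psi>} mod l"
        using cong_count_dvd dvd q ckl by blast
      then show "case q of (c, k, l, \<psi>) \<Rightarrow>
          compare c (card {b\<in>nodes t'. sat t' (env a b) \<psi>} mod l) k"
        using q ckl mod g[OF a] unfolding models_iff by fastforce
    }
  qed
qed

section \<open>Replacing forests\<close>

text \<open>The forest of a vertex consists of the subtrees rooted at the vertex and at its right siblings:
  it is a subtree in the first-child/next-sibling encoding, so that cutting out a part of a path and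
  cutting out an interval of siblings become instances of the same surgery. The regions record what
  a vertex outside the forest must know about the inside (the first three) and vice versa.\<close>

datatype forest_region =
    Self_Reg | Foll_Reg | Below_Reg
  | Parent_Reg | Anc_Reg | Left_Reg | Prec_Reg | Other_Reg

text \<open>The root gets only one, uninformative, region; since it lacks \<open>Self_Reg\<close>, region counts
  tell it apart from all other vertices.\<close>

fun region :: "nat list \<Rightarrow> nat list \<Rightarrow> forest_region" where
  "region [] b = Other_Reg"
| "region [i] [] = Parent_Reg"
| "region [i] (k # y) =
     (if k < i then
        (if y = [] then (if Suc k = i then Left_Reg else Prec_Reg) else Other_Reg)
      else if y \<noteq> [] then Below_Reg
      else if k = i then Self_Reg else Foll_Reg)"
| "region (i # j # u) [] = Anc_Reg"
| "region (i # j # u) (k # y) = (if i = k then region (j # u) y else Other_Reg)"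

definition inner_regions :: "forest_region set" where
  "inner_regions = {Self_Reg, Foll_Reg, Below_Reg}"

definition forest :: "nat list \<Rightarrow> nat list set" where
  "forest u = {b. region u b \<in> inner_regions}"

section \<open>Coordinates and positions relative to a forest\<close>

lemma region_Cons_snoc [simp]:
  "region (i # p @ [j]) [] = Anc_Reg"
  "region (i # p @ [j]) (k # y) = (if i = k then region (p @ [j]) y else Other_Reg)"
  by (cases p; simp)+

lemma region_forest:
  "region (p @ [i]) (p @ (i + d) # y) =
     (if y \<noteq> [] then Below_Reg else if d = 0 then Self_Reg else Foll_Reg)"
  by (induction p) auto

text \<open>Gives coordinates inside a forest: \<open>d\<close> counts the steps to the right along
  the siblings, \<open>y\<close> is the way down from there.\<close>

lemma forest_iff: "b \<in> forest (p @ [i]) \<longleftrightarrow> (\<exists>d y. b = p @ (i + d) # y)"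
proof
  show "b \<in> forest (p @ [i]) \<Longrightarrow> \<exists>d y. b = p @ (i + d) # y"
  proof (induction p arbitrary: b)
    case Nil
    then show ?case
      by (cases b) (auto simp: forest_def inner_regions_def split: if_splits intro: le_Suc_ex)
  next
    case (Cons a p)
    then show ?case
      by (cases b) (auto simp: forest_def inner_regions_def split: if_splits)
  qed
next
  show "\<exists>d y. b = p @ (i + d) # y \<Longrightarrow> b \<in> forest (p @ [i])"
    by (auto simp: forest_def inner_regions_def region_forest split: if_split_asm)
qed

text \<open>The vertex with coordinates \<open>d\<close>, \<open>y\<close> looks at a vertex outside
  the forest. The last clause also catches the inner regions, where the value is a mere
  default.\<close>

fun pos_from_forest :: "nat \<Rightarrow> nat list \<Rightarrow> forest_region \<Rightarrow> position" where
  "pos_from_forest d y Parent_Reg = (if y = [] then Parent_Pos else Anc_Pos)"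
| "pos_from_forest d y Anc_Reg = Anc_Pos"
| "pos_from_forest d y Left_Reg =
     (if y = [] then (if d = 0 then Left_Pos else Prec_Pos) else Free_Pos)"
| "pos_from_forest d y Prec_Reg = (if y = [] then Prec_Pos else Free_Pos)"
| "pos_from_forest d y _ = Free_Pos"

text \<open>The base \<open>p @ [i]\<close> enters the right-hand side only through the region.
  Hence a vertex keeping its coordinates can be moved to another forest and sees an outside vertex
  of equal region in the same position.\<close>

lemma pos_outside_forest:
  "b \<notin> forest (p @ [i]) \<Longrightarrow>
    pos (p @ (i + d) # y) b = pos_from_forest d y (region (p @ [i]) b)"
proof (induction p arbitrary: b)
  case Nil
  then show ?case
    by (cases b) (auto simp: forest_def inner_regions_def split: if_splits)
next
  case (Cons a p)
  then show ?case
    by (cases b) (auto simp: forest_def inner_regions_def split: if_splits)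
qed

lemma pos_into_forest:
  assumes "a \<notin> forest (p @ [i])" "b \<in> forest (p @ [i])" "b' \<in> forest (p @ [i])"
    and "region (p @ [i]) b = region (p @ [i]) b'"
  shows "pos a b = pos a b'"
proof -
  obtain d y d' y' where b: "b = p @ (i + d) # y" "b' = p @ (i + d') # y'"
    using assms(2,3) unfolding forest_iff by blast
  \<comment> \<open>The inner region reveals just whether \<open>y\<close> is empty and, if so,
    whether \<open>d\<close> is 0; \<open>pos_from_forest\<close> depends on nothing else.\<close>
  then have "(y = []) = (y' = [])" "y = [] \<Longrightarrow> (d = 0) = (d' = 0)"
    using assms(4) by (auto simp: region_forest split: if_splits)
  then have "pos_from_forest d y r = pos_from_forest d' y' r" for r
    by (cases r) auto
  then have "pos b a = pos b' a"
    unfolding b pos_outside_forest[OF assms(1)] by simp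
  then show ?thesis
    by (metis pos_converse)
qed

text \<open>The root of the smaller forest is either \<open>p @ [i]\<close> or one of its right
  siblings, or lies properly below one of these.\<close>

lemma forest_trans:
  assumes "q @ [j] \<in> forest (p @ [i])"
  shows "forest (q @ [j]) \<subseteq> forest (p @ [i])"
proof
  fix b assume "b \<in> forest (q @ [j])"
  then obtain e z where b: "b = q @ (j + e) # z"
    unfolding forest_iff by blast
  obtain d y where y: "q @ [j] = p @ (i + d) # y"
    using assms unfolding forest_iff by blast
  show "b \<in> forest (p @ [i])"
  proof (cases y rule: rev_cases)
    case Nil
    with y have "q = p" "j = i + d"
      by auto
    with b have "b = p @ (i + (d + e)) # z"
      by (simp add: add.assoc)
    then show ?thesis
      unfolding forest_iff by blast
  next
    case (snoc y' k)
    with y have "(q @ [j]) = (p @ (i + d) # y') @ [k]"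
      by simp
    then have "q = p @ (i + d) # y'"
      by blast
    with b have "b = p @ (i + d) # (y' @ (j + e) # z)"
      by simp
    then show ?thesis
      unfolding forest_iff by blast
  qed
qed

lemma forest_antisym:
  assumes "q @ [j] \<in> forest (p @ [i])" "p @ [i] \<in> forest (q @ [j])"
  shows "p @ [i] = q @ [j]"
proof -
  obtain d y where y: "q @ [j] = p @ (i + d) # y"
    using assms(1) unfolding forest_iff by blast
  obtain d' y' where y': "p @ [i] = q @ (j + d') # y'"
    using assms(2) unfolding forest_iff by blast
  have "length q = length p + length y" "length p = length q + length y'"
    using arg_cong[OF y, of length] arg_cong[OF y', of length] by auto
  then have "y = []" "y' = []"
    by auto
  with y y' show ?thesis
    by auto
qed

section \<open>The surgery\<close>

definition region_profile ::
    "'p set \<Rightarrow> 'p tree \<Rightarrow> nat list \<Rightarrow> nat list \<Rightarrow> forest_region \<times> 'p set" where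
  "region_profile P t u b = (region u b, label t b \<inter> P)"

text \<open>The new tree keeps \<open>C\<close>, the outside of the forest of \<open>u\<close>, and
  puts at \<open>u\<close> a copy \<open>F\<close> of the forest of \<open>v\<close>;
  \<open>g\<close> sends copies to originals. Kept vertices need equal counts inside the two
  forests, copied vertices need equal counts outside them, and the hypothesis supplies both.\<close>

lemma replace_forest:
  fixes t :: "'p tree"
  assumes u: "p @ [i] \<in> nodes t" and v: "q @ [j] \<in> nodes t"
    and vu: "q @ [j] \<in> forest (p @ [i])" "q @ [j] \<noteq> p @ [i]"
    and sim: "similar L (nodes t) (region_profile P t (p @ [i]))
      (nodes t) (region_profile P t (q @ [j]))"
  obtains t' g where "card (nodes t') < card (nodes t)"
    and "\<And>a. a \<in> nodes t' \<Longrightarrow> g a \<in> nodes t"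
    and "\<And>a. a \<in> nodes t' \<Longrightarrow> label t' a = label t (g a)"
    and "\<And>a. a \<in> nodes t' \<Longrightarrow> similar L (nodes t') (profile P t' a) (nodes t) (profile P t (g a))"
proof -
  let ?u = "p @ [i]" and ?v = "q @ [j]"
  \<comment> \<open>Keeps the coordinates and changes the base. The truncated subtraction recovers
    \<open>d\<close>, because indices at this level of the forest are at least
    \<open>i\<close>.\<close>
  define g where "g w = (if w \<in> forest ?u
    then q @ (j + (hd (drop (length p) w) - i)) # tl (drop (length p) w) else w)" for w
  have g_in: "g (p @ (i + d) # y) = q @ (j + d) # y" for d y
    unfolding g_def forest_iff by auto
  have g_out: "g w = w" if "w \<notin> forest ?u" for w
    using that by (simp add: g_def)
  define C where "C = nodes t - forest ?u"
  define F where "F = {w \<in> forest ?u. g w \<in> nodes t}"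
  define S where "S = C \<union> F"
  have S_iff: "w \<in> S \<longleftrightarrow> g w \<in> nodes t" for w
    using g_out unfolding S_def C_def F_def by auto
  have Fv: "q @ (j + d) # y \<in> forest ?v" for d y
    unfolding forest_iff by blast
  have bijF: "bij_betw g F (nodes t \<inter> forest ?v)"
    unfolding bij_betw_def
  proof
    show "inj_on g F"
      unfolding F_def by (rule inj_onI) (auto simp: forest_iff g_in)
    show "g ` F = nodes t \<inter> forest ?v"
    proof
      show "g ` F \<subseteq> nodes t \<inter> forest ?v"
        unfolding F_def by (auto simp: forest_iff[of _ p] g_in Fv)
      show "nodes t \<inter> forest ?v \<subseteq> g ` F"
      proof
        fix b assume b: "b \<in> nodes t \<inter> forest ?v"
        then obtain d y where "b = q @ (j + d) # y"
          by (auto simp: forest_iff)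
        with b have "p @ (i + d) # y \<in> F" "b = g (p @ (i + d) # y)"
          unfolding F_def forest_iff by (auto simp: g_in)
        then show "b \<in> g ` F"
          by blast
      qed
    qed
  qed
  have finC: "finite C"
    by (simp add: C_def finite_nodes)
  have finF: "finite F"
    using bij_betw_finite[OF bijF] finite_nodes by blast
  have fin: "finite (nodes t \<inter> X)" "finite (nodes t - X)" for X
    by (simp_all add: finite_nodes)
  have disj: "C \<inter> F = {}"
    unfolding C_def F_def by blast
  have sub: "forest ?v \<subseteq> forest ?u"
    using forest_trans vu(1) .
  have u_notin: "?u \<notin> forest ?v"
    using forest_antisym[OF vu(1)] vu(2) by metis
  have u_self: "?u \<in> forest ?u"
    unfolding forest_iff by (metis add_0_right)
  \<comment> \<open>Up to the bijection with the copy, \<open>S\<close> is a set of old vertices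
    that misses \<open>u\<close>.\<close>
  have "card S = card C + card (nodes t \<inter> forest ?v)"
    unfolding S_def using finC finF disj bij_betw_same_card[OF bijF] by (simp add: card_Un_disjoint)
  also have "\<dots> = card (C \<union> (nodes t \<inter> forest ?v))"
    using finC fin sub by (intro card_Un_disjoint[symmetric]) (auto simp: C_def)
  also have "\<dots> < card (nodes t)"
    using u u_notin u_self by (intro psubset_card_mono[OF finite_nodes]) (auto simp: C_def)
  finally have cardS: "card S < card (nodes t)" .
  have "\<exists>t'. nodes t' = S \<and> (\<forall>w\<in>S. label t' w = label t (g w))"
  proof (rule tree_with_domain)
    show "finite S"
      using finC finF by (simp add: S_def)
    have "[] \<notin> forest ?u"
      by (auto simp: forest_iff)
    then show "[] \<in> S"
      by (simp add: S_def C_def)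
    show "w \<in> S" if w: "w @ [k] \<in> S" for w k
    proof (cases "w @ [k] \<in> forest ?u")
      case False
      then have "w \<notin> forest ?u"
        by (auto simp: forest_iff)
      with False w show ?thesis
        using nodes_appendD by (auto simp: S_iff g_out)
    next
      case True
      then obtain d y where y: "w @ [k] = p @ (i + d) # y"
        unfolding forest_iff by blast
      show ?thesis
      proof (cases y rule: rev_cases)
        case Nil
        with y have "w = p"
          by auto
        moreover have "p \<notin> forest ?u"
          by (auto simp: forest_iff)
        ultimately show ?thesis
          using nodes_appendD[OF u] by (simp add: S_iff g_out)
      next
        case (snoc y' l)
        with y have "w @ [k] = (p @ (i + d) # y') @ [l]"
          by simp
        then have "w = p @ (i + d) # y'"
          by blast
        moreover have "g (p @ (i + d) # y) \<in> nodes t"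
          using w unfolding S_iff y .
        ultimately show ?thesis
          using nodes_appendD[of "q @ (j + d) # y'" "[l]" t] snoc by (simp add: S_iff g_in)
      qed
    qed
    show "w @ [k] \<in> S" if w: "w @ [Suc k] \<in> S" for w k
    proof (cases "w @ [Suc k] \<in> forest ?u")
      case False
      \<comment> \<open>A forest is closed under right siblings.\<close>
      have "w @ [k] \<notin> forest ?u"
      proof
        assume "w @ [k] \<in> forest ?u"
        then obtain d y where y: "w @ [k] = p @ (i + d) # y"
          unfolding forest_iff by blast
        have "w @ [Suc k] \<in> forest (w @ [k])"
          unfolding forest_iff by (metis add_Suc_right add_0_right)
        then show False
          using False forest_trans[of w k p i] \<open>w @ [k] \<in> forest ?u\<close> by blast
      qed
      with False w show ?thesis
        using nodes_left_sibling[of w "Suc k" t k] by (auto simp: S_iff g_out)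
    next
      case True
      then obtain d y where y: "w @ [Suc k] = p @ (i + d) # y"
        unfolding forest_iff by blast
      then have gy: "q @ (j + d) # y \<in> nodes t"
        using w unfolding S_iff y g_in by simp
      show ?thesis
      proof (cases y rule: rev_cases)
        case Nil
        with y have wk: "w = p" "Suc k = i + d"
          by auto
        show ?thesis
        proof (cases d)
          case 0
          \<comment> \<open>The left sibling of \<open>u\<close> is outside the forest and stays
            where it was.\<close>
          with wk have "p @ [k] \<notin> forest ?u"
            by (auto simp: forest_iff)
          then show ?thesis
            using nodes_left_sibling[OF u, of k] wk 0 by (simp add: S_iff g_out)
        next
          case (Suc e)
          with wk have "w @ [k] = p @ (i + e) # []"
            by simp
          then have "g (w @ [k]) = q @ [j + e]"
            using g_in[of e "[]"] by simp
          then show ?thesis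
            using nodes_left_sibling[of q "j + d" t "j + e"] gy Nil Suc by (simp add: S_iff)
        qed
      next
        case (snoc y' l)
        with y have "w @ [Suc k] = (p @ (i + d) # y') @ [l]"
          by simp
        then have wl: "w = p @ (i + d) # y'" "l = Suc k"
          by (metis append1_eq_conv)+
        then have "g (w @ [k]) = (q @ (j + d) # y') @ [k]"
          using g_in[of d "y' @ [k]"] by simp
        then show ?thesis
          using nodes_left_sibling[of "q @ (j + d) # y'" "Suc k" t k] gy snoc wl by (simp add: S_iff)
      qed
    qed
  qed
  then obtain t' where t': "nodes t' = S" "\<And>w. w \<in> S \<Longrightarrow> label t' w = label t (g w)"
    by blast
  \<comment> \<open>Splitting the hypothesis by inner and other regions separates the counts inside
    the forests from those outside.\<close>
  have simF: "similar L (nodes t \<inter> forest ?u) (region_profile P t ?u)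
      (nodes t \<inter> forest ?v) (region_profile P t ?v)"
    using similar_filter[OF sim, of "\<lambda>(r, _). r \<in> inner_regions"]
    by (simp add: region_profile_def forest_def Int_def)
  have simC: "similar L (nodes t - forest ?u) (region_profile P t ?u)
      (nodes t - forest ?v) (region_profile P t ?v)"
    using similar_filter[OF sim, of "\<lambda>(r, _). r \<notin> inner_regions"]
    by (simp add: region_profile_def forest_def set_diff_eq)
  have "similar L S (profile P t' a) (nodes t) (profile P t (g a))" if a: "a \<in> S" for a
  proof (cases "a \<in> forest ?u")
    case False
    \<comment> \<open>For a kept vertex, the copy \<open>F\<close> matches the forest of
      \<open>v\<close>, which by \<open>simF\<close> matches the removed forest of \<open>u\<close>;
      equal regions look the same from outside.\<close>
    have "similar L F (region_profile P t' ?u) (nodes t \<inter> forest ?v) (region_profile P t ?v)"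
    proof (rule similar_bij[OF bijF])
      fix b assume b: "b \<in> F"
      then obtain d y where "b = p @ (i + d) # y"
        unfolding F_def forest_iff by blast
      then show "region_profile P t' ?u b = region_profile P t ?v (g b)"
        using t'(2)[of b] b by (simp add: region_profile_def g_in region_forest S_def)
    qed
    from similar_trans[OF this similar_sym[OF simF]]
    have "similar L F (profile P t' a) (nodes t \<inter> forest ?u) (profile P t (g a))"
      by (rule similar_coarsen[OF finF fin(1)])
        (use pos_into_forest[OF False] in
          \<open>auto simp: region_profile_def profile_def g_out False F_def\<close>)
    moreover have "similar L C (profile P t' a) C (profile P t (g a))"
      using t'(2) False
      by (intro similar_bij[of id]) (auto simp: profile_def C_def S_def g_out)
    ultimately have "similar L (C \<union> F) (profile P t' a) (C \<union> (nodes t \<inter> forest ?u)) (profile P t (g a))"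
      using finC finF fin disj by (intro similar_Un) (auto simp: C_def)
    moreover have "C \<union> (nodes t \<inter> forest ?u) = nodes t"
      unfolding C_def by blast
    ultimately show ?thesis
      unfolding S_def by simp
  next
    case True
    then obtain d y where a_eq: "a = p @ (i + d) # y"
      unfolding forest_iff by blast
    \<comment> \<open>Inside the copy, both branch indices are shifted by the same amount, which
      preserves positions.\<close>
    have "similar L F (profile P t' a) (nodes t \<inter> forest ?v) (profile P t (g a))"
    proof (rule similar_bij[OF bijF])
      fix b assume b: "b \<in> F"
      then obtain d' y' where "b = p @ (i + d') # y'"
        unfolding F_def forest_iff by blast
      then show "profile P t' a b = profile P t (g a) (g b)"
        using t'(2)[of b] b by (simp add: profile_def g_in a_eq S_def)
    qed
    \<comment> \<open>The copy sees \<open>C\<close>, whereas its original sees everything outside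
      the forest of \<open>v\<close>, including what lies between the two forests;
      \<open>simC\<close> equates the counts.\<close>
    moreover have "similar L C (profile P t' a) (nodes t - forest ?v) (profile P t (g a))"
      unfolding C_def
    proof (rule similar_coarsen[OF fin(2) fin(2) simC])
      fix b b' assume b: "b \<in> nodes t - forest ?u" "b' \<in> nodes t - forest ?v"
        and eq: "region_profile P t ?u b = region_profile P t ?v b'"
      have "label t' b = label t b"
        using t'(2)[of b] b(1) by (simp add: S_def C_def g_out)
      then show "profile P t' a b = profile P t (g a) b'"
        using b eq by (simp add: profile_def region_profile_def a_eq g_in pos_outside_forest)
    qed
    ultimately have "similar L (C \<union> F) (profile P t' a)
        ((nodes t - forest ?v) \<union> (nodes t \<inter> forest ?v)) (profile P t (g a))"
      using finC finF fin disj by (intro similar_Un) auto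
    moreover have "(nodes t - forest ?v) \<union> (nodes t \<inter> forest ?v) = nodes t"
      by blast
    ultimately show ?thesis
      unfolding S_def by simp
  qed
  then show ?thesis
    using that[of t' g] cardS t' S_iff by metis
qed

section \<open>Minimal models\<close>

text \<open>Restriction to a domain that is finite for finite \<open>P\<close> makes states
  countable as elements of a function space; each key takes at most \<open>2 * L\<close> values when
  \<open>L\<close> is positive.\<close>

definition state :: "nat \<Rightarrow> 'p set \<Rightarrow> 'p tree \<Rightarrow> nat list \<Rightarrow> forest_region \<times> 'p set \<Rightarrow> nat \<times> bool" where
  "state L P t u = (\<lambda>k\<in>UNIV \<times> Pow P.
     let n = card {b\<in>nodes t. region_profile P t u b = k} in (n mod L, n = 0))"

lemma similar_of_state_eq:
  fixes P :: "'p set"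
  assumes "state L P t u = state L P t v"
  shows "similar L (nodes t) (region_profile P t u) (nodes t) (region_profile P t v)"
  unfolding similar_def
proof
  fix k :: "forest_region \<times> 'p set"
  show "cong_count L (card {b\<in>nodes t. region_profile P t u b = k})
      (card {b\<in>nodes t. region_profile P t v b = k})"
  proof (cases "k \<in> UNIV \<times> Pow P")
    case True
    then show ?thesis
      using fun_cong[OF assms, of k] by (simp add: state_def cong_count_def Let_def)
  next
    case False
    then have "{b\<in>nodes t. region_profile P t u b = k} = {}"
      "{b\<in>nodes t. region_profile P t v b = k} = {}"
      by (auto simp: region_profile_def)
    then show ?thesis
      by (simp only: cong_count_refl)
  qed
qed

lemma UNIV_region: "UNIV = {Self_Reg, Foll_Reg, Below_Reg, Parent_Reg, Anc_Reg, Left_Reg,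
    Prec_Reg, Other_Reg}"
  using forest_region.exhaust by blast

lemma finite_region: "finite (UNIV :: forest_region set)"
  by (simp add: UNIV_region)

lemma card_region: "card (UNIV :: forest_region set) = 8"
  by (simp add: UNIV_region)

lemma card_states:
  fixes P :: "'p set"
  assumes "finite P" "0 < L" "finite A"
  shows "card (state L P t ` A) \<le> (2 * L) ^ (8 * 2 ^ card P)"
proof -
  let ?D = "UNIV \<times> Pow P :: (forest_region \<times> 'p set) set"
  let ?E = "PiE ?D (\<lambda>_. {..<L} \<times> (UNIV :: bool set))"
  have finD: "finite ?D"
    using assms(1) finite_region by simp
  have "state L P t ` A \<subseteq> ?E"
    using assms(2) by (intro image_subsetI) (simp add: state_def Let_def restrict_PiE_iff)
  then have "card (state L P t ` A) \<le> card ?E"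
    using finD by (intro card_mono finite_PiE) auto
  also have "\<dots> = (L * 2) ^ card ?D"
    using finD by (simp add: card_PiE)
  also have "card ?D = 8 * 2 ^ card P"
    using assms(1) by (simp add: card_cartesian_product card_region card_Pow)
  finally show ?thesis
    by (simp add: mult.commute)
qed

text \<open>Covers both kinds of chain to be bounded, paths and sets of siblings. Descendants of
  right siblings are left out although they belong to the forest.\<close>

definition forest_order :: "nat list \<Rightarrow> nat list \<Rightarrow> bool" where
  "forest_order u v \<longleftrightarrow> pos u v \<in> {Child_Pos, Desc_Pos, Right_Pos, Foll_Pos}"

lemma forest_orderD:
  assumes "forest_order (p @ [i]) v"
  shows "v \<in> forest (p @ [i])"
proof (cases "pos (p @ [i]) v \<in> {Child_Pos, Desc_Pos}")
  case True
  then obtain w where "v = p @ (i + 0) # w"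
    unfolding pos_below by auto
  then show ?thesis
    unfolding forest_iff by blast
next
  case False
  with assms have "pos (p @ [i]) v \<in> {Right_Pos, Foll_Pos}"
    by (auto simp: forest_order_def)
  then obtain w k j where "k < j" "p @ [i] = w @ [k]" "v = w @ [j]"
    unfolding pos_following by blast
  then have "v = p @ (i + (j - i)) # []"
    by simp
  then show ?thesis
    unfolding forest_iff by blast
qed

text \<open>A non-root vertex counts itself in \<open>Self_Reg\<close>, the root counts nothing
  there. This removes the root, which has no forest of the form used in the surgery.\<close>

lemma state_root_neq:
  assumes "p @ [i] \<in> nodes t"
  shows "state L P t [] \<noteq> state L P t (p @ [i])"
proof
  assume "state L P t [] = state L P t (p @ [i])"
  from similar_obtain[OF similar_sym[OF similar_of_state_eq[OF this]] finite_nodes assms]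
  obtain b where "region_profile P t [] b = region_profile P t (p @ [i]) (p @ [i])"
    by blast
  then show False
    using region_forest[of p i 0 "[]"] by (simp add: region_profile_def)
qed

lemma state_neq_in_minimal_model:
  assumes nf: "normal_form \<phi>" and mod: "models t \<phi>"
    and min: "\<And>t'. models t' \<phi> \<Longrightarrow> card (nodes t) \<le> card (nodes t')"
    and uv: "u \<in> nodes t" "v \<in> nodes t" "forest_order u v"
  shows "state (prod_list (moduli \<phi>)) (preds \<phi>) t u \<noteq> state (prod_list (moduli \<phi>)) (preds \<phi>) t v"
proof
  let ?L = "prod_list (moduli \<phi>)"
  assume eq: "state ?L (preds \<phi>) t u = state ?L (preds \<phi>) t v"
  \<comment> \<open>Nothing precedes the root in \<open>forest_order\<close>, so \<open>v\<close> is
    not the root; then \<open>u\<close> is not either, since its state would differ.\<close>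
  have "v \<noteq> u" "v \<noteq> []"
    using uv(3) by (cases u; auto simp: forest_order_def split: if_splits)+
  then obtain q j where v: "v = q @ [j]"
    by (metis rev_exhaust)
  then obtain p i where u: "u = p @ [i]"
    using eq uv state_root_neq by (metis rev_exhaust)
  obtain t' g where t': "card (nodes t') < card (nodes t)"
    "\<And>a. a \<in> nodes t' \<Longrightarrow> g a \<in> nodes t"
    "\<And>a. a \<in> nodes t' \<Longrightarrow> label t' a = label t (g a)"
    "\<And>a. a \<in> nodes t' \<Longrightarrow>
      similar ?L (nodes t') (profile (preds \<phi>) t' a) (nodes t) (profile (preds \<phi>) t (g a))"
    using replace_forest[of p i t q j ?L "preds \<phi>"] uv forest_orderD \<open>v \<noteq> u\<close>
      similar_of_state_eq[OF eq] unfolding u v by blast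
  have "models t' \<phi>"
    using models_transfer[OF nf mod, of t' g] t' by simp
  with min t'(1) show False
    by (simp add: leD)
qed

text \<open>Every set of unary symbols of the formula labels a one-vertex tree, whose literals form
  a 1-type; distinct sets give distinct types.\<close>

lemma card_one_types: "2 ^ card (preds \<phi>) \<le> card (one_types \<phi>)"
  for \<phi> :: "'p fo2"
proof -
  define T where "T A = {f \<in> literals_x \<phi>. sat (Node A []) (\<lambda>_. []) f}" for A
  have "T A \<in> one_types \<phi>" for A
    unfolding one_types_def
  proof (intro CollectI conjI allI impI)
    show "T A \<subseteq> literals_x \<phi>"
      by (auto simp: T_def)
    show "satisfiable_x (T A)"
      unfolding satisfiable_x_def T_def using Nil_in_nodes by blast
    fix S assume S: "T A \<subset> S \<and> S \<subseteq> literals_x \<phi>"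
    then obtain f where f: "f \<in> S" "f \<notin> T A" "f \<in> literals_x \<phi>"
      by blast
    \<comment> \<open>Maximality: the type already contains a literal contradicting any literal
      outside it.\<close>
    have "\<exists>h\<in>T A. \<forall>t s. sat t s h \<longleftrightarrow> \<not> sat t s f"
    proof (cases "f \<in> atoms_x \<phi>")
      case True
      with f have "Neg f \<in> T A"
        by (auto simp: T_def literals_x_def)
      then show ?thesis
        by force
    next
      case False
      with f obtain h where "f = Neg h" "h \<in> atoms_x \<phi>"
        by (auto simp: literals_x_def)
      with f have "h \<in> T A"
        by (auto simp: T_def literals_x_def)
      with \<open>f = Neg h\<close> show ?thesis
        by force
    qed
    with S f(1) show "\<not> satisfiable_x S"
      unfolding satisfiable_x_def by blast
  qed
  moreover have "inj_on T (Pow (preds \<phi>))"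
  proof (rule inj_onI)
    fix A B assume AB: "A \<in> Pow (preds \<phi>)" "B \<in> Pow (preds \<phi>)" "T A = T B"
    have "Pred p X \<in> T D \<longleftrightarrow> p \<in> D" if "p \<in> preds \<phi>" for p D
      using that by (auto simp: T_def literals_x_def atoms_x_def label_def)
    with AB show "A = B"
      by blast
  qed
  moreover have "finite (one_types \<phi>)"
  proof (rule finite_subset)
    show "one_types \<phi> \<subseteq> Pow (literals_x \<phi>)"
      by (auto simp: one_types_def)
    show "finite (Pow (literals_x \<phi>))"
      using finite_preds[of \<phi>] by (simp add: literals_x_def atoms_x_def)
  qed
  ultimately have "card (Pow (preds \<phi>)) \<le> card (one_types \<phi>)"
    by (metis card_inj_on_le image_subsetI)
  then show ?thesis
    by (simp add: card_Pow finite_preds)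
qed

lemma chain_bound_in_minimal_model:
  fixes \<phi> :: "'p fo2"
  assumes nf: "normal_form \<phi>" and "models t \<phi>"
    and "\<And>t'. models t' \<phi> \<Longrightarrow> card (nodes t) \<le> card (nodes t')"
    and A: "A \<subseteq> nodes t"
    and chain: "\<And>u v. u \<in> A \<Longrightarrow> v \<in> A \<Longrightarrow> u \<noteq> v \<Longrightarrow> forest_order u v \<or> forest_order v u"
  shows "card A \<le> size_bound \<phi>"
proof -
  let ?L = "prod_list (moduli \<phi>)" and ?P = "preds \<phi>"
  have "wf_mod \<phi>"
    using nf by (simp add: normal_form_def)
  then have "0 \<notin> set (moduli \<phi>)"
    using moduli_pos by blast
  then have L: "0 < ?L"
    by (metis gr0I prod_list_zero_iff)
  have "inj_on (state ?L ?P t) A"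
  proof (rule inj_onI, rule ccontr)
    fix u v assume uv: "u \<in> A" "v \<in> A" "state ?L ?P t u = state ?L ?P t v" "u \<noteq> v"
    then show False
      using state_neq_in_minimal_model[OF assms(1-3)] chain[OF uv(1,2,4)] A by (metis subsetD)
  qed
  then have "card A = card (state ?L ?P t ` A)"
    by (simp add: card_image)
  also have "\<dots> \<le> (2 * ?L) ^ (8 * 2 ^ card ?P)"
    using A finite_nodes by (intro card_states finite_preds L) (auto intro: finite_subset)
  \<comment> \<open>Compares the exponents \<open>8 * 2 ^ card ?P\<close> and
    \<open>10 * card (one_types \<phi>)\<close>; the base is at least 1.\<close>
  also have "\<dots> \<le> size_bound \<phi>"
    unfolding size_bound_def using card_one_types[of \<phi>] L by (intro power_increasing) auto
  finally show ?thesis .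
qed

theorem theorem10:
  fixes \<phi> :: "'p fo2"
  assumes "normal_form \<phi>"
    and "satisfiable \<phi>"
  shows "\<exists>t. models t \<phi> \<and>
    (\<forall>us. path t us \<longrightarrow> length us \<le> size_bound \<phi>) \<and>
    (\<forall>u\<in>nodes t. degree t u \<le> size_bound \<phi>)"
proof -
  obtain t0 where "models t0 \<phi>"
    using assms(2) by (auto simp: satisfiable_def)
  \<comment> \<open>One model with the fewest vertices serves for both bounds.\<close>
  then obtain t where t: "models t \<phi>" "\<And>t'. models t' \<phi> \<Longrightarrow> card (nodes t) \<le> card (nodes t')"
    using ex_has_least_nat[of "\<lambda>t. models t \<phi>" t0 "\<lambda>t. card (nodes t)"] by blast
  note bound = chain_bound_in_minimal_model[OF assms(1) t]
  have "length us \<le> size_bound \<phi>" if us: "path t us" for us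
  proof -
    \<comment> \<open>Being a proper descendant is transitive, so it holds between any earlier and
      later vertex of the path, not just neighbours; in particular no vertex repeats.\<close>
    let ?R = "\<lambda>u v. pos u v \<in> {Child_Pos, Desc_Pos}"
    have "successively ?R us"
      using us unfolding path_def
      by (auto elim!: successively_mono simp: child_iff subset_iff)
    moreover have "transp ?R"
      unfolding pos_below by (rule transpI) (metis append_assoc append_is_Nil_conv)
    ultimately have sorted: "sorted_wrt ?R us"
      using successively_conv_sorted_wrt by blast
    then have "distinct us"
      by (induction us) auto
    have "forest_order u v \<or> forest_order v u" if "u \<in> set us" "v \<in> set us" "u \<noteq> v" for u v
      using sorted that by (induction us) (auto simp: forest_order_def)
    then have "card (set us) \<le> size_bound \<phi>"
      using us by (intro bound) (auto simp: path_def)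
    with \<open>distinct us\<close> show ?thesis
      by (simp add: distinct_card)
  qed
  moreover have "degree t u \<le> size_bound \<phi>" if "u \<in> nodes t" for u
    unfolding degree_def
  proof (rule bound)
    show "{v. (u, v) \<in> child t} \<subseteq> nodes t"
      by (auto simp: child_def)
    fix v w assume "v \<in> {v. (u, v) \<in> child t}" "w \<in> {v. (u, v) \<in> child t}" "v \<noteq> w"
    then obtain i j where "v = u @ [i]" "w = u @ [j]" "i \<noteq> j"
      by (auto simp: child_def)
    then show "forest_order v w \<or> forest_order w v"
      by (auto simp: forest_order_def)
  qed
  ultimately show ?thesis
    using t(1) by blast
qed

end
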